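(* Let $G(n,p)$ denote the set of all simple graphs on $n$ vertices where each edge is chosen independently with probability $p$, and let $P(G(n,p))$ be the probability of a graph from $G(n,p)$ having diameter $2$. If $p=\frac{1}{2}$, then $$P(G(n,1/2))\geq 1-\frac{4n^2(3/4)^n}{9}.$$
   Context: The diameter of a graph $G$ is the maximum number of edges in $G$ that are needed to traverse from one vertex to another in $G$, where paths that backtrack, detour, or loop are excluded (that is, the maximum graph distance between two vertices).
   Formalization: The formal statement assumes n ≥ 2: for n = 1 the only graph has diameter 0, so the probability is 0 while the claimed lower bound is 2/3 (and for n = 0 it is 0 against 1). *)

theory Defs
  imports "HOL-Probability.Probability" "Graph_Theory.Graph_Theory"
begin

text \<open>
  Graphs are the symmetric digraphs of Graph_Theory. With unit arc weights, the weighted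
  distance \<open>\<mu>\<close> is the usual graph distance: the least number of edges of a walk from
  \<open>u\<close> to \<open>v\<close>, and \<open>\<infinity>\<close> if there is none. In particular, a disconnected graph has
  diameter \<open>\<infinity>\<close>.
\<close>

definition graph_diameter :: "('a, 'b) pre_digraph \<Rightarrow> ereal" where
  "graph_diameter G = (SUP u \<in> verts G. SUP v \<in> verts G. wf_digraph.\<mu> G (\<lambda>_. 1) u v)"

definition potential_edges :: "nat \<Rightarrow> nat set set" where
  "potential_edges n = {e. e \<subseteq> {..<n} \<and> card e = 2}"

text \<open>An undirected edge \<open>{u, v}\<close> is represented by the two arcs \<open>(u, v)\<close> and \<open>(v, u)\<close>.\<close>

definition graph_of_edges :: "nat \<Rightarrow> nat set set \<Rightarrow> nat pair_pre_digraph" where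
  "graph_of_edges n E = \<lparr> pverts = {..<n}, parcs = {(u, v). {u, v} \<in> E} \<rparr>"

definition random_graph :: "nat \<Rightarrow> real \<Rightarrow> nat pair_pre_digraph pmf" where
  "random_graph n p =
     map_pmf (\<lambda>f. graph_of_edges n {e. f e})
       (Pi_pmf (potential_edges n) False (\<lambda>_. bernoulli_pmf p))"

definition prob_diameter_two :: "nat \<Rightarrow> real \<Rightarrow> real" where
  "prob_diameter_two n p =
     measure_pmf.prob (random_graph n p) {G. graph_diameter (with_proj G) = 2}"

lemma finite_potential_edges: "finite (potential_edges n)"
  by (rule finite_subset[of _ "Pow {..<n}"]) (auto simp: potential_edges_def)

lemma pair_graph_graph_of_edges:
  assumes "E \<subseteq> potential_edges n"
  shows "pair_graph (graph_of_edges n E)"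
proof -
  have *: "u < n \<and> v < n \<and> u \<noteq> v" if "{u, v} \<in> E" for u v
  proof -
    have "{u, v} \<subseteq> {..<n}" "card {u, v} = 2"
      using that assms by (auto simp: potential_edges_def)
    then show ?thesis by (cases "u = v") auto
  qed
  have fin: "finite {(u, v). {u, v} \<in> E}"
    by (rule finite_subset[of _ "{..<n} \<times> {..<n}"]) (auto dest: *)
  show ?thesis
    by unfold_locales
      (auto simp: graph_of_edges_def fin symmetric_def arcs_ends_def arc_to_ends_def
        with_proj_def sym_def insert_commute dest: *)
qed

lemma random_graph_pair_graph:
  assumes "G \<in> set_pmf (random_graph n p)"
  shows "pair_graph G" and "pverts G = {..<n}"
proof -
  obtain f where f: "f \<in> set_pmf (Pi_pmf (potential_edges n) False (\<lambda>_. bernoulli_pmf p))"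
    and G: "G = graph_of_edges n {e. f e}"
    using assms by (auto simp: random_graph_def)
  have "f e = False" if "e \<notin> potential_edges n" for e
    using f that set_Pi_pmf_subset'[OF finite_potential_edges, of n False "\<lambda>_. bernoulli_pmf p"]
    by (auto simp: PiE_dflt_def)
  then have "{e. f e} \<subseteq> potential_edges n" by blast
  then show "pair_graph G" using G pair_graph_graph_of_edges by simp
  show "pverts G = {..<n}" using G by (simp add: graph_of_edges_def)
qed

end

theory Submission
  imports Defs
begin

text \<open>
  If the diameter is not \<open>2\<close>, then either the graph is complete or some pair of
  vertices is neither adjacent nor joined by a path of length two. For a fixed pair, the potential
  edges concerned fall into disjoint blocks (the pair itself, and the two edges through each of the
  \<open>n - 2\<close> other vertices), so the latter event has probability
  \<open>(1 - p) * (1 - p\<^sup>2) ^ (n - 2)\<close>. For \<open>p = 1/2\<close>, the union bound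
  over all pairs gives \<open>4 * n * (n - 1) * (3/4) ^ n / 9\<close>, and the difference to the
  claimed bound, \<open>4 * n * (3/4) ^ n / 9\<close>, absorbs the probability of the complete graph.
\<close>

section \<open>Distances with unit weights and diameter two\<close>

lemma (in wf_digraph) unit_awalk_cost: "awalk_cost (\<lambda>_. 1) p = real (length p)"
  by (induction p) auto

lemma (in wf_digraph) unit_distance_le_two:
  assumes "u \<in> verts G"
    and "u = v \<or> u \<rightarrow>\<^bsub>G\<^esub> v \<or> (\<exists>w. u \<rightarrow>\<^bsub>G\<^esub> w \<and> w \<rightarrow>\<^bsub>G\<^esub> v)"
  shows "\<mu> (\<lambda>_. 1) u v \<le> 2"
proof -
  have "\<exists>p. awalk u p v \<and> length p \<le> 2"
    using assms(2)
  proof (elim disjE exE conjE)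
    assume "u = v"
    then show ?thesis
      using assms(1) by (intro exI[of _ "[]"]) (simp add: awalk_Nil_iff)
  next
    assume "u \<rightarrow>\<^bsub>G\<^esub> v"
    then obtain e where "e \<in> arcs G" "tail G e = u" "head G e = v"
      by auto
    then show ?thesis
      by (intro exI[of _ "[e]"]) (auto simp: awalk_simps)
  next
    fix w assume w: "u \<rightarrow>\<^bsub>G\<^esub> w" "w \<rightarrow>\<^bsub>G\<^esub> v"
    obtain e where "e \<in> arcs G" "tail G e = u" "head G e = w"
      using w(1) by auto
    moreover obtain e' where "e' \<in> arcs G" "tail G e' = w" "head G e' = v"
      using w(2) by auto
    ultimately show ?thesis
      by (intro exI[of _ "[e, e']"]) (auto simp: awalk_simps)
  qed
  then obtain p where p: "awalk u p v" "length p \<le> 2"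
    by blast
  have "\<mu> (\<lambda>_. 1) u v \<le> ereal (awalk_cost (\<lambda>_. 1) p)"
    using p(1) by (rule min_cost_le_walk_cost)
  also have "\<dots> \<le> 2"
    using p(2) by (simp add: unit_awalk_cost)
  finally show ?thesis .
qed

lemma (in wf_digraph) unit_distance_ge_two:
  assumes "u \<noteq> v" and "\<not> u \<rightarrow>\<^bsub>G\<^esub> v"
  shows "\<mu> (\<lambda>_. 1) u v \<ge> 2"
  unfolding \<mu>_def
proof (rule INF_greatest)
  fix p assume "p \<in> {p. awalk u p v}"
  then have p: "awalk u p v" by simp
  have "length p \<ge> 2"
  proof (cases p)
    case Nil
    with p assms(1) show ?thesis by (simp add: awalk_Nil_iff)
  next
    case (Cons e q)
    show ?thesis
    proof (cases q)
      case Nil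
      with Cons p have "e \<in> arcs G" "tail G e = u" "head G e = v"
        by (auto simp: awalk_simps)
      then have "u \<rightarrow>\<^bsub>G\<^esub> v" using in_arcs_imp_in_arcs_ends by metis
      with assms(2) show ?thesis by simp
    qed (use Cons in simp)
  qed
  then show "2 \<le> ereal (awalk_cost (\<lambda>_. 1) p)"
    by (simp add: unit_awalk_cost)
qed

text \<open>The hypothesis \<open>close\<close> bounds the supremum above by 2, and the non-adjacent
  pair \<open>u\<close>, \<open>v\<close> bounds it below by 2.\<close>

lemma (in wf_digraph) graph_diameter_eq_two:
  assumes close: "\<And>u v. u \<in> verts G \<Longrightarrow> v \<in> verts G \<Longrightarrow> u \<noteq> v \<Longrightarrow>
      u \<rightarrow>\<^bsub>G\<^esub> v \<or> (\<exists>w. u \<rightarrow>\<^bsub>G\<^esub> w \<and> w \<rightarrow>\<^bsub>G\<^esub> v)"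
    and uv: "u \<in> verts G" "v \<in> verts G" "u \<noteq> v" "\<not> u \<rightarrow>\<^bsub>G\<^esub> v"
  shows "graph_diameter G = 2"
  unfolding graph_diameter_def
proof (rule antisym)
  show "(SUP u\<in>verts G. SUP v\<in>verts G. \<mu> (\<lambda>_. 1) u v) \<le> 2"
    using close by (intro SUP_least unit_distance_le_two) auto
  have "2 \<le> \<mu> (\<lambda>_. 1) u v"
    using uv by (intro unit_distance_ge_two)
  also have "\<dots> \<le> (SUP u\<in>verts G. SUP v\<in>verts G. \<mu> (\<lambda>_. 1) u v)"
    using uv by (intro SUP_upper2[of u] SUP_upper2[of v]) auto
  finally show "2 \<le> (SUP u\<in>verts G. SUP v\<in>verts G. \<mu> (\<lambda>_. 1) u v)" .
qed

text \<open>Translates the criterion to edge sets. The condition \<open>common\<close> is indexed by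
  missing edges rather than ordered vertex pairs, so that the later union bound counts each
  unordered pair once.\<close>

lemma graph_diameter_graph_of_edges_eq_two:
  assumes E: "E \<subseteq> potential_edges n" and "E \<noteq> potential_edges n"
    and common: "\<And>e. e \<in> potential_edges n - E \<Longrightarrow> \<exists>w<n. w \<notin> e \<and> (\<forall>x\<in>e. {x, w} \<in> E)"
  shows "graph_diameter (with_proj (graph_of_edges n E)) = 2"
proof -
  interpret pair_graph "graph_of_edges n E"
    using E by (rule pair_graph_graph_of_edges)
  have adj: "(u, v) \<in> parcs (graph_of_edges n E) \<longleftrightarrow> {u, v} \<in> E" for u v
    by (simp add: graph_of_edges_def)
  have verts: "pverts (graph_of_edges n E) = {..<n}"
    by (simp add: graph_of_edges_def)
  obtain e where "e \<in> potential_edges n" "e \<notin> E"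
    using assms by blast
  then obtain u v where uv: "u < n" "v < n" "u \<noteq> v" "{u, v} \<notin> E"
    by (auto simp: potential_edges_def card_2_iff)
  have "{x, y} \<in> E \<or> (\<exists>w. {x, w} \<in> E \<and> {w, y} \<in> E)" if "x < n" "y < n" "x \<noteq> y" for x y
    using common[of "{x, y}"] that by (auto simp: potential_edges_def insert_commute)
  then show ?thesis
    using uv by (intro graph_diameter_eq_two[of u v]) (auto simp: adj verts)
qed

section \<open>Independent coin flips on disjoint blocks\<close>

lemma prob_Pi_pmf_bernoulli_all:
  assumes "finite I" and "J \<subseteq> I" and "0 \<le> p" "p \<le> 1"
  shows "measure_pmf.prob (Pi_pmf I d (\<lambda>_. bernoulli_pmf p)) {f. \<forall>i\<in>J. f i} = p ^ card J"
proof -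
  have "{f. \<forall>i\<in>J. f i} = Pi I (\<lambda>i. if i \<in> J then {True} else UNIV)"
    using assms(2) by (auto simp: Pi_def)
  then have "measure_pmf.prob (Pi_pmf I d (\<lambda>_. bernoulli_pmf p)) {f. \<forall>i\<in>J. f i} =
      (\<Prod>i\<in>I. if i \<in> J then p else 1)"
    using assms by (simp add: measure_Pi_pmf_Pi measure_pmf_single if_distrib cong: if_cong)
  also have "\<dots> = p ^ card J"
    using assms by (simp add: prod.If_cases Int_absorb1)
  finally show ?thesis .
qed

text \<open>Restrictions of \<open>f\<close> to disjoint coordinate blocks are independent, so the
  probability factors over \<open>L\<close>; each factor is the complement of an all-true
  event.\<close>

lemma prob_Pi_pmf_bernoulli_disjoint_blocks:
  assumes "finite I" and "finite L" and K: "\<And>j. j \<in> L \<Longrightarrow> K j \<subseteq> I"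
    and disj: "disjoint_family_on K L" and p: "0 \<le> p" "p \<le> 1"
  shows "measure_pmf.prob (Pi_pmf I d (\<lambda>_. bernoulli_pmf p)) {f. \<forall>j\<in>L. \<exists>i\<in>K j. \<not> f i} =
    (\<Prod>j\<in>L. 1 - p ^ card (K j))"
\<comment> \<open>For empty \<open>L\<close> both sides are 1; the product rule for independent
  variables requires a nonempty index set.\<close>
proof (cases "L = {}")
  case False
  let ?M = "Pi_pmf I d (\<lambda>_. bernoulli_pmf p)"
  let ?X = "\<lambda>j f. restrict (\<lambda>i. f i) (K j) :: _ \<Rightarrow> bool"
  let ?S = "\<lambda>j. PiM (K j) (\<lambda>_. count_space (UNIV :: bool set))"
  \<comment> \<open>The block event, as a set in the product space over \<open>K j\<close>; its
    preimage under \<open>?X j\<close> is the event on \<open>f\<close>.\<close>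
  define A where "A j = {g \<in> space (?S j). \<exists>i\<in>K j. \<not> g i}" for j
  have indep: "prob_space.indep_vars ?M ?S ?X L"
    using measure_pmf.prob_space_axioms indep_vars_Pi_pmf[OF \<open>finite I\<close>] K disj
    by (rule prob_space.indep_vars_restrict)
  have fin: "finite (K j)" if "j \<in> L" for j
    using K[OF that] \<open>finite I\<close> by (rule finite_subset)
  have sets: "A j \<in> sets (?S j)" if "j \<in> L" for j
    using fin[OF that] unfolding A_def by measurable
  have vimage: "?X j -` A j = {f. \<exists>i\<in>K j. \<not> f i}" for j
    by (auto simp: A_def space_PiM)
  have block: "measure_pmf.prob ?M {f. \<exists>i\<in>K j. \<not> f i} = 1 - p ^ card (K j)" if "j \<in> L" for j
  proof -
    have "{f. \<exists>i\<in>K j. \<not> f i} = space ?M - {f. \<forall>i\<in>K j. f i}"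
      by auto
    then show ?thesis
      using prob_Pi_pmf_bernoulli_all[OF \<open>finite I\<close> K[OF that] p]
      by (simp only: measure_pmf.prob_compl[of "{f. \<forall>i\<in>K j. f i}"] sets_measure_pmf UNIV_I)
  qed
  have "{f. \<forall>j\<in>L. \<exists>i\<in>K j. \<not> f i} = (\<Inter>j\<in>L. ?X j -` A j \<inter> space ?M)"
    by (simp only: vimage) auto
  also have "measure_pmf.prob ?M \<dots> = (\<Prod>j\<in>L. measure_pmf.prob ?M (?X j -` A j \<inter> space ?M))"
    using measure_pmf.prob_space_axioms indep False \<open>finite L\<close> sets
    by (rule prob_space.indep_varsD_finite)
  also have "\<dots> = (\<Prod>j\<in>L. 1 - p ^ card (K j))"
    by (intro prod.cong refl) (simp only: vimage space_measure_pmf Int_UNIV_right block)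
  finally show ?thesis .
qed simp

lemma prob_no_short_path:
  assumes e: "e \<in> potential_edges n" and p: "0 \<le> p" "p \<le> 1"
  shows "measure_pmf.prob (Pi_pmf (potential_edges n) d (\<lambda>_. bernoulli_pmf p))
      {f. \<not> f e \<and> (\<forall>w<n. w \<notin> e \<longrightarrow> (\<exists>x\<in>e. \<not> f {x, w}))} = (1 - p) * (1 - p\<^sup>2) ^ (n - 2)"
proof -
  obtain u v where uv: "e = {u, v}" "u \<noteq> v" "u < n" "v < n"
    using e by (auto simp: potential_edges_def card_2_iff)
  \<comment> \<open>The index \<open>u\<close> is reused for the block consisting of \<open>e\<close> alone.\<close>
  define K where "K w = (if w = u then {e} else {{u, w}, {v, w}})" for w
  let ?W = "{..<n} - {u, v}"
  let ?L = "insert u ?W"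
  have "{f. \<not> f e \<and> (\<forall>w<n. w \<notin> e \<longrightarrow> (\<exists>x\<in>e. \<not> f {x, w}))} = {f. \<forall>w\<in>?L. \<exists>i\<in>K w. \<not> f i}"
    by (auto simp: K_def uv)
  also have "measure_pmf.prob (Pi_pmf (potential_edges n) d (\<lambda>_. bernoulli_pmf p)) \<dots> =
      (\<Prod>w\<in>?L. 1 - p ^ card (K w))"
  proof (rule prob_Pi_pmf_bernoulli_disjoint_blocks)
    show "K w \<subseteq> potential_edges n" if "w \<in> ?L" for w
      using that e uv by (auto simp: K_def potential_edges_def)
    \<comment> \<open>As \<open>w\<close> lies outside \<open>{u, v}\<close>, either of the edges
      \<open>{u, w}\<close> and \<open>{v, w}\<close> determines \<open>w\<close>, and neither
      equals \<open>e\<close>.\<close>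
    show "disjoint_family_on K ?L"
      using uv by (auto simp: disjoint_family_on_def K_def doubleton_eq_iff)
  qed (use p finite_potential_edges in auto)
  also have "\<dots> = (1 - p) * (\<Prod>w\<in>?W. 1 - p ^ card (K w))"
    by (simp add: K_def)
  \<comment> \<open>The edges \<open>{u, w}\<close> and \<open>{v, w}\<close> differ because
    \<open>u \<noteq> v\<close>, so these blocks have size 2.\<close>
  also have "(\<Prod>w\<in>?W. 1 - p ^ card (K w)) = (\<Prod>w\<in>?W. 1 - p\<^sup>2)"
    using uv by (intro prod.cong) (auto simp: K_def doubleton_eq_iff power2_eq_square)
  also have "\<dots> = (1 - p\<^sup>2) ^ (n - 2)"
    using uv by (simp add: card_Diff_subset numeral_2_eq_2)
  finally show ?thesis .
qed

section \<open>Union bound over all pairs of vertices\<close>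

lemma card_potential_edges: "card (potential_edges n) = n choose 2"
  unfolding potential_edges_def by (simp add: n_subsets)

lemma prob_diameter_two_ge:
  fixes p :: real
  assumes p: "0 \<le> p" "p \<le> 1"
  shows "prob_diameter_two n p \<ge>
    1 - (n choose 2) * ((1 - p) * (1 - p\<^sup>2) ^ (n - 2)) - p ^ (n choose 2)"
proof -
  let ?E = "potential_edges n"
  let ?M = "Pi_pmf ?E False (\<lambda>_. bernoulli_pmf p)"
  let ?D = "{f. graph_diameter (with_proj (graph_of_edges n {e. f e})) = 2}"
  \<comment> \<open>\<open>C\<close> is the event of a complete graph, \<open>B e\<close> the event
    that the endpoints of \<open>e\<close> are at distance greater than 2.\<close>
  define C where "C = {f. \<forall>e\<in>?E. f e}"
  define B where "B e = {f. \<not> f e \<and> (\<forall>w<n. w \<notin> e \<longrightarrow> (\<exists>x\<in>e. \<not> f {x, w}))}" for e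
  \<comment> \<open>On the support, \<open>f\<close> takes the default value \<open>False\<close>
    outside \<open>?E\<close>, so its true set is a genuine edge set. Intersecting with the support
    leaves the probability unchanged.\<close>
  have "- ?D \<inter> set_pmf ?M \<subseteq> C \<union> (\<Union>e\<in>?E. B e)"
  proof
    fix f assume f: "f \<in> - ?D \<inter> set_pmf ?M"
    have sub: "{e. f e} \<subseteq> ?E"
      using f set_Pi_pmf_subset[OF finite_potential_edges, of n False "\<lambda>_. bernoulli_pmf p"]
      by auto
    show "f \<in> C \<union> (\<Union>e\<in>?E. B e)"
    proof (rule ccontr)
      assume "f \<notin> C \<union> (\<Union>e\<in>?E. B e)"
      then have "graph_diameter (with_proj (graph_of_edges n {e. f e})) = 2"
        using sub by (intro graph_diameter_graph_of_edges_eq_two) (auto simp: C_def B_def)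
      with f show False by simp
    qed
  qed
  then have "measure_pmf.prob ?M (- ?D) \<le> measure_pmf.prob ?M (C \<union> (\<Union>e\<in>?E. B e))"
    by (subst measure_Int_set_pmf[symmetric]) (intro measure_pmf.finite_measure_mono, auto)
  also have "\<dots> \<le> measure_pmf.prob ?M C + measure_pmf.prob ?M (\<Union>e\<in>?E. B e)"
    by (intro measure_Un_le) auto
  also have "measure_pmf.prob ?M (\<Union>e\<in>?E. B e) \<le> (\<Sum>e\<in>?E. measure_pmf.prob ?M (B e))"
    by (intro measure_UNION_le finite_potential_edges) auto
  also have "\<dots> = (n choose 2) * ((1 - p) * (1 - p\<^sup>2) ^ (n - 2))"
    by (simp add: B_def prob_no_short_path p card_potential_edges)
  also have "measure_pmf.prob ?M C = p ^ (n choose 2)"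
    unfolding C_def
    by (simp add: prob_Pi_pmf_bernoulli_all finite_potential_edges p card_potential_edges)
  finally have "measure_pmf.prob ?M (- ?D) \<le>
      p ^ (n choose 2) + (n choose 2) * ((1 - p) * (1 - p\<^sup>2) ^ (n - 2))"
    by simp
  moreover have "prob_diameter_two n p = measure_pmf.prob ?M ?D"
    by (simp add: prob_diameter_two_def random_graph_def vimage_def)
  moreover have "measure_pmf.prob ?M (- ?D) = 1 - measure_pmf.prob ?M ?D"
    using measure_pmf.prob_compl[of ?D ?M] by (simp add: Compl_eq_Diff_UNIV)
  ultimately show ?thesis by linarith
qed

section \<open>Numerical estimates for edge probability one half\<close>

text \<open>Equality holds at \<open>n = 2\<close>. From \<open>n\<close> to \<open>Suc n\<close>
  the left side gains the factor \<open>(1/2) ^ n\<close>, at most 1/4, while the right side gains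
  at least 3/4.\<close>

lemma half_power_choose_two_le:
  assumes "n \<ge> 2"
  shows "(1/2 :: real) ^ (n choose 2) \<le> 4 * n * (3/4) ^ n / 9"
  using assms
proof (induction n rule: dec_induct)
  case base
  show ?case by (simp add: power2_eq_square)
next
  case (step n)
  have "(1/2 :: real) ^ (Suc n choose 2) = (1/2) ^ n * (1/2) ^ (n choose 2)"
    by (simp add: numeral_2_eq_2 power_add)
  also have "\<dots> \<le> (3/4) * (4 * n * (3/4) ^ n / 9)"
  proof (rule mult_mono)
    have "(1/2 :: real) ^ n \<le> (1/2) ^ 2"
      using step.hyps by (intro power_decreasing) auto
    then show "(1/2 :: real) ^ n \<le> 3/4" by (simp add: power2_eq_square)
  qed (use step in auto)
  also have "\<dots> \<le> 4 * real (Suc n) * (3/4) ^ Suc n / 9"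
    by (simp add: field_simps)
  finally show ?case .
qed

theorem corollary1p3:
  fixes n :: nat
  assumes "n \<ge> 2"
  shows "prob_diameter_two n (1/2) \<ge> 1 - 4 * (real n)^2 * (3/4)^n / 9"
proof -
  have choose: "real (n choose 2) = real n * (real n - 1) / 2"
    using assms by (simp add: choose_two real_of_nat_div of_nat_diff)
  have "(3/4 :: real) ^ n = (3/4) ^ (n - 2) * (3/4)\<^sup>2"
    using assms by (metis le_add_diff_inverse2 power_add)
  then have "(3/4 :: real) ^ (n - 2) = 16/9 * (3/4) ^ n"
    by (simp add: power2_eq_square)
  \<comment> \<open>The constant is 1/2 from the binomial coefficient, times 1/2 from
    \<open>1 - p\<close>, times 16/9 from the shifted exponent, that is 4/9.\<close>
  then have "real (n choose 2) * ((1 - 1/2) * (1 - (1/2)\<^sup>2) ^ (n - 2)) =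
      4 * real n * (real n - 1) * (3/4) ^ n / 9"
    by (simp add: choose power2_eq_square)
  \<comment> \<open>The complete graph contributes the missing \<open>n\<close> in
    \<open>n * (n - 1) + n = n\<^sup>2\<close>.\<close>
  moreover have "4 * real n * (real n - 1) * (3/4) ^ n / 9 + 4 * real n * (3/4) ^ n / 9 =
      4 * (real n)\<^sup>2 * (3/4) ^ n / 9"
    by (simp add: field_simps power2_eq_square)
  ultimately show ?thesis
    using prob_diameter_two_ge[of "1/2" n] half_power_choose_two_le[OF assms] by simp
qed

end
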